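(* Let $0<n\le m$ be integers, let $m_1,\dots,m_n$ be positive integers with $\sum_{j=1}^n m_j=m$, and let $C=(C_{ij})\in\mathbb{R}^{m\times n}$ be a real cost matrix. Consider the optimization problem $$\text{(P)}\qquad \min_{X'\in\mathcal{U}'}\ \sum_{i=1}^m\sum_{j=1}^n X'_{ij}C_{ij},\qquad \mathcal{U}'=\Big\{X'\in\mathbb{R}^{m\times n}:\ X'_{ij}\ge 0,\ \sum_{j=1}^n X'_{ij}=\tfrac1m,\ \sum_{i=1}^m X'_{ij}=\tfrac{m_j}{m}\ \ \forall\, 1\le i\le m,\ 1\le j\le n\Big\},$$ and the optimization problem $$\text{(Q)}\qquad \min_{X\in\mathcal{U}}\ \sum_{i=1}^m\sum_{j=1}^n \tfrac1m X_{ij}C_{ij},\qquad \mathcal{U}=\Big\{X\in\{0,1\}^{m\times n}:\ \sum_{j=1}^n X_{ij}=1,\ \sum_{i=1}^m X_{ij}=m_j\ \ \forall\, 1\le i\le m,\ 1\le j\le n\Big\}.$$ Then (P) and (Q) are equivalent: their optimal values are equal, and a matrix $X\in\mathcal{U}$ is optimal for (Q) if and only if $\tfrac1m X\in\mathcal{U}'$ is optimal for (P).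
   Context: Costs are real-valued. All problems are finite-dimensional minimization problems over the displayed feasible sets. *)

theory Defs
  imports "HOL-Analysis.Analysis"
begin

text \<open>
  An \<open>m \<times> n\<close> real matrix has type \<^typ>\<open>real ^ 'n ^ 'm\<close>, with row index type \<open>'m\<close> and column index
  type \<open>'n\<close>, so that \<open>m = CARD('m)\<close>, \<open>n = CARD('n)\<close>, and \<open>X $ i $ j\<close> is the entry in row \<open>i\<close> and
  column \<open>j\<close>. The integers \<open>m\<^sub>j\<close> are given by a function \<open>k :: 'n \<Rightarrow> nat\<close>.
\<close>

definition feasible_P :: "('n::finite \<Rightarrow> nat) \<Rightarrow> (real ^ 'n ^ 'm::finite) set" where
  "feasible_P k = {X. (\<forall>i j. X $ i $ j \<ge> 0) \<and>
                      (\<forall>i. (\<Sum>j\<in>UNIV. X $ i $ j) = 1 / real CARD('m)) \<and>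
                      (\<forall>j. (\<Sum>i\<in>UNIV. X $ i $ j) = real (k j) / real CARD('m))}"

definition cost_P :: "real ^ 'n ^ 'm \<Rightarrow> real ^ 'n::finite ^ 'm::finite \<Rightarrow> real" where
  "cost_P C X = (\<Sum>i\<in>UNIV. \<Sum>j\<in>UNIV. X $ i $ j * C $ i $ j)"

definition feasible_Q :: "('n::finite \<Rightarrow> nat) \<Rightarrow> (real ^ 'n ^ 'm::finite) set" where
  "feasible_Q k = {X. (\<forall>i j. X $ i $ j \<in> {0, 1}) \<and>
                      (\<forall>i. (\<Sum>j\<in>UNIV. X $ i $ j) = 1) \<and>
                      (\<forall>j. (\<Sum>i\<in>UNIV. X $ i $ j) = real (k j))}"

definition cost_Q :: "real ^ 'n ^ 'm \<Rightarrow> real ^ 'n::finite ^ 'm::finite \<Rightarrow> real" where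
  "cost_Q C X = (\<Sum>i\<in>UNIV. \<Sum>j\<in>UNIV. 1 / real CARD('m) * X $ i $ j * C $ i $ j)"

abbreviation optimal_on :: "('a \<Rightarrow> real) \<Rightarrow> 'a set \<Rightarrow> 'a \<Rightarrow> bool" where
  "optimal_on f S x \<equiv> is_arg_min f (\<lambda>y. y \<in> S) x"

text \<open>
  On the reals, \<open>Inf\<close> is meaningful only for nonempty sets that are bounded below, so
  \<open>optimal_value f S\<close> is the minimum of \<open>f\<close> on \<open>S\<close> exactly when some \<open>x\<close> satisfies
  \<open>optimal_on f S x\<close>; existence of such an \<open>x\<close> has to be asserted separately.
\<close>
definition optimal_value :: "('a \<Rightarrow> real) \<Rightarrow> 'a set \<Rightarrow> real" where
  "optimal_value f S = (INF x\<in>S. f x)"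

end

theory Submission
  imports Defs
begin

text \<open>
  The feasible set of (P) is compact and convex, so by Krein--Milman it is the convex hull of its
  extreme points. If \<open>X\<close> is feasible and \<open>m X\<close> has a non-integral entry, then, the row and column sums
  of \<open>m X\<close> being integers, every row and every column that meets the set \<open>F\<close> of non-integral positions
  meets it at least twice. Hence \<open>F\<close> has at least as many elements as there are such rows and columns
  together, and since the row sums and the column sums of a matrix have the same total, there is a
  nonzero matrix \<open>D\<close> supported on \<open>F\<close> with vanishing row and column sums. Then \<open>X\<close> is the midpoint of
  the feasible matrices \<open>X + e D\<close> and \<open>X - e D\<close>, so it is not extreme. Thus the linear cost is
  minimised over the feasible set of (P) at a multiple \<open>1/m\<close> of a feasible matrix of (Q).
\<close>

section \<open>Circulations supported on a prescribed set of positions\<close>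

text \<open>Each fibre of \<open>p\<close> over its image has at least two elements, and the fibre
  sizes add up to \<open>card F\<close>. With \<open>p\<close> a coordinate projection this bounds
  the number of rows or columns that meet \<open>F\<close>.\<close>

lemma two_le_fibre_imp_two_card_image_le:
  assumes "finite F" "\<And>e. e \<in> F \<Longrightarrow> \<exists>e'\<in>F. e' \<noteq> e \<and> p e' = p e"
  shows "2 * card (p ` F) \<le> card F"
proof -
  have "2 \<le> card {e\<in>F. p e = y}" if y: "y \<in> p ` F" for y
  proof -
    obtain e e' where e: "e \<in> F" "p e = y" "e' \<in> F" "e' \<noteq> e" "p e' = y"
      using y assms(2) by blast
    then have "card {e, e'} \<le> card {e\<in>F. p e = y}"
      by (intro card_mono) (use assms(1) in auto)
    then show ?thesis using e by simp
  qed
  then have "(\<Sum>y\<in>p ` F. 2) \<le> (\<Sum>y\<in>p ` F. card {e\<in>F. p e = y})"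
    by (intro sum_mono)
  also have "\<dots> = card F"
    using sum.group[of F "p ` F" p "\<lambda>_. 1::nat"] assms(1) by simp
  finally show ?thesis by simp
qed

text \<open>A dimension count: \<open>L\<close> takes a matrix to its row and column sums, and it
  maps \<open>V\<close>, of dimension \<open>card F\<close>, into a proper subspace of
  \<open>W\<close>, of dimension at most \<open>card F\<close>. Hence it has a nonzero kernel vector
  on \<open>V\<close>.\<close>

lemma ex_nonzero_circulation:
  fixes F :: "('m::finite \<times> 'n::finite) set"
  assumes "F \<noteq> {}"
    and row: "\<And>i j. (i, j) \<in> F \<Longrightarrow> \<exists>j'. j' \<noteq> j \<and> (i, j') \<in> F"
    and col: "\<And>i j. (i, j) \<in> F \<Longrightarrow> \<exists>i'. i' \<noteq> i \<and> (i', j) \<in> F"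
  shows "\<exists>D :: real ^ 'n ^ 'm. D \<noteq> 0 \<and> (\<forall>i j. (i, j) \<notin> F \<longrightarrow> D $ i $ j = 0) \<and>
    (\<forall>i. (\<Sum>j\<in>UNIV. D $ i $ j) = 0) \<and> (\<forall>j. (\<Sum>i\<in>UNIV. D $ i $ j) = 0)"
proof -
  \<comment> \<open>Matrices are flattened to vectors indexed by pairs, so that a support condition
    describes a coordinate subspace. \<open>Inl\<close> indexes row sums, \<open>Inr\<close> column
    sums.\<close>
  define L :: "real ^ ('m \<times> 'n) \<Rightarrow> real ^ ('m + 'n)" where
    "L D = (\<chi> s. case s of Inl i \<Rightarrow> \<Sum>j\<in>UNIV. D $ (i, j) | Inr j \<Rightarrow> \<Sum>i\<in>UNIV. D $ (i, j))" for D
  define V :: "(real ^ ('m \<times> 'n)) set" where "V = {D. \<forall>e. e \<notin> F \<longrightarrow> D $ e = 0}"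
  define S where "S = Inl ` fst ` F \<union> (Inr ` snd ` F :: ('m + 'n) set)"
  define W :: "(real ^ ('m + 'n)) set" where "W = {u. \<forall>s. s \<notin> S \<longrightarrow> u $ s = 0}"
  have lin: "linear L"
    by (rule linearI)
      (auto simp: L_def vec_eq_iff sum.distrib sum_distrib_left split: sum.split)
  have subV: "subspace V" and subW: "subspace W"
    by (auto simp: V_def W_def subspace_def)
  have "2 * card (fst ` F) \<le> card F"
    by (rule two_le_fibre_imp_two_card_image_le) (use row in force)+
  moreover have "2 * card (snd ` F) \<le> card F"
    by (rule two_le_fibre_imp_two_card_image_le) (use col in force)+
  moreover have "card S \<le> card (fst ` F) + card (snd ` F)"
    unfolding S_def by (rule order.trans[OF card_Un_le]) (simp add: card_image)
  \<comment> \<open>Rows and columns each contribute at most half of \<open>card F\<close>.\<close>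
  ultimately have "card S \<le> card F" by simp
  then have dimWV: "dim W \<le> dim V"
    unfolding W_def V_def dim_vec_eq[symmetric] dim_substandard_cart .
  have "L ` V \<subseteq> W"
  proof
    fix u assume "u \<in> L ` V"
    then obtain D where D: "u = L D" "\<And>e. e \<notin> F \<Longrightarrow> D $ e = 0" by (auto simp: V_def)
    have "u $ s = 0" if "s \<notin> S" for s
    proof (cases s)
      case (Inl i)
      then have "(i, j) \<notin> F" for j using that by (force simp: S_def)
      then show ?thesis using D Inl by (simp add: L_def)
    next
      case (Inr j)
      then have "(i, j) \<notin> F" for i using that by (force simp: S_def)
      then show ?thesis using D Inr by (simp add: L_def)
    qed
    then show "u \<in> W" by (simp add: W_def)
  qed
  \<comment> \<open>A preimage of the unit vector at a row index would have entries with total 1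
    when summed by rows and 0 when summed by columns.\<close>
  moreover have "W \<noteq> L ` V"
  proof
    assume WL: "W = L ` V"
    obtain i j where ij: "(i, j) \<in> F" using \<open>F \<noteq> {}\<close> by auto
    then have "Inl i \<in> S" by (force simp: S_def)
    then have "axis (Inl i) 1 \<in> W" by (auto simp: W_def axis_def)
    then obtain D where D: "axis (Inl i) 1 = L D" using WL by blast
    have r: "(\<Sum>j\<in>UNIV. D $ (a, j)) = (if a = i then 1 else 0)" for a
      using arg_cong[OF D, of "\<lambda>u. u $ Inl a"] by (auto simp: L_def axis_def)
    have c: "(\<Sum>i\<in>UNIV. D $ (i, b)) = 0" for b
      using arg_cong[OF D, of "\<lambda>u. u $ Inr b"] by (auto simp: L_def axis_def)
    have "(\<Sum>a\<in>UNIV. \<Sum>b\<in>UNIV. D $ (a, b)) = 1" by (simp add: r)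
    moreover have "(\<Sum>a\<in>UNIV. \<Sum>b\<in>UNIV. D $ (a, b)) = 0"
      by (subst sum.swap) (simp add: c)
    ultimately show False by simp
  qed
  ultimately have "L ` V \<subset> W" by blast
  moreover have "span (L ` V) = L ` V" "span W = W" and spanV: "span V = V"
    using linear_subspace_image[OF lin subV] subV subW by (simp_all only: span_eq_iff)
  ultimately have "dim (L ` V) < dim W" by (intro dim_psubset) (simp only:)
  then have "\<not> inj_on L V"
    using dim_image_eq[OF lin, of V] spanV dimWV by auto
  then obtain D where D: "D \<in> V" "D \<noteq> 0" "L D = 0"
    using linear_injective_on_subspace_0[OF lin subV] by blast
  show ?thesis
  proof (intro exI[of _ "\<chi> i j. D $ (i, j)"] conjI allI impI)
    show "(\<chi> i j. D $ (i, j)) \<noteq> 0" using D(2) by (auto simp: vec_eq_iff)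
    show "(\<chi> i j. D $ (i, j)) $ i $ j = 0" if "(i, j) \<notin> F" for i j
      using D(1) that by (simp add: V_def)
    show "(\<Sum>j\<in>UNIV. (\<chi> i j. D $ (i, j)) $ i $ j) = 0" for i
      using arg_cong[OF D(3), of "\<lambda>u. u $ Inl i"] by (simp add: L_def)
    show "(\<Sum>i\<in>UNIV. (\<chi> i j. D $ (i, j)) $ i $ j) = 0" for j
      using arg_cong[OF D(3), of "\<lambda>u. u $ Inr j"] by (simp add: L_def)
  qed
qed

section \<open>Integrality of the extreme points\<close>

lemma ex_other_non_Int_summand:
  fixes f :: "'a \<Rightarrow> 'b::ring_1"
  assumes "finite A" "sum f A \<in> \<int>" "a \<in> A" "f a \<notin> \<int>"
  shows "\<exists>b\<in>A. b \<noteq> a \<and> f b \<notin> \<int>"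
proof (rule ccontr)
  assume "\<not> ?thesis"
  then have "sum f (A - {a}) \<in> \<int>" by (intro Ints_sum) auto
  moreover have "f a = sum f A - sum f (A - {a})"
    using assms by (simp add: sum.remove)
  ultimately show False using assms by (metis Ints_diff)
qed

lemma scaleR_feasible_Q_in_feasible_P:
  fixes X :: "real ^ 'n::finite ^ 'm::finite"
  assumes "X \<in> feasible_Q k"
  shows "(1 / real CARD('m)) *\<^sub>R X \<in> feasible_P k"
proof -
  have "0 \<le> X $ i $ j" for i j
    using assms by (auto simp: feasible_Q_def dest!: spec[of _ i] spec[of _ j])
  then show ?thesis
    using assms by (auto simp: feasible_Q_def feasible_P_def simp flip: sum_divide_distrib)
qed

lemma extreme_point_of_feasible_P:
  fixes X :: "real ^ 'n::finite ^ 'm::finite"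
  assumes "X extreme_point_of feasible_P k"
  shows "real CARD('m) *\<^sub>R X \<in> feasible_Q k"
proof -
  let ?m = "real CARD('m)"
  have m: "?m > 0" by simp
  have X: "X \<in> feasible_P k" using assms by (simp add: extreme_point_of_def)
  then have nonneg: "0 \<le> X $ i $ j" for i j by (simp add: feasible_P_def)
  have row: "(\<Sum>j\<in>UNIV. ?m * X $ i $ j) = 1" for i
    using X by (simp add: feasible_P_def flip: sum_distrib_left)
  have col: "(\<Sum>i\<in>UNIV. ?m * X $ i $ j) = real (k j)" for j
    using X by (simp add: feasible_P_def flip: sum_distrib_left)
  define F where "F = {(i, j). ?m * X $ i $ j \<notin> \<int>}"
  have "F = {}"
  proof (rule ccontr)
    assume "F \<noteq> {}"
    have rowF: "\<exists>j'. j' \<noteq> j \<and> (i, j') \<in> F" if "(i, j) \<in> F" for i j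
      using that ex_other_non_Int_summand[of UNIV "\<lambda>j. ?m * X $ i $ j" j] by (auto simp: F_def row)
    have colF: "\<exists>i'. i' \<noteq> i \<and> (i', j) \<in> F" if "(i, j) \<in> F" for i j
      using that ex_other_non_Int_summand[of UNIV "\<lambda>i. ?m * X $ i $ j" i] by (auto simp: F_def col)
    obtain D :: "real ^ 'n ^ 'm" where D: "D \<noteq> 0"
      "\<And>i j. (i, j) \<notin> F \<Longrightarrow> D $ i $ j = 0"
      "\<And>i. (\<Sum>j\<in>UNIV. D $ i $ j) = 0" "\<And>j. (\<Sum>i\<in>UNIV. D $ i $ j) = 0"
      using ex_nonzero_circulation[OF \<open>F \<noteq> {}\<close> rowF colF] by blast
    \<comment> \<open>The step size \<open>e\<close> keeps every entry of
      \<open>e *\<^sub>R D\<close> within \<open>b\<close>, the least entry of \<open>X\<close> on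
      \<open>F\<close>. It is positive because a zero entry of \<open>X\<close> would give an
      integral position.\<close>
    define b where "b = Min ((\<lambda>(i, j). X $ i $ j) ` F)"
    define e where "e = b / norm D"
    have "0 < X $ i $ j" if "(i, j) \<in> F" for i j
      using that nonneg[of i j] by (cases "X $ i $ j = 0") (auto simp: F_def)
    then have "0 < b" unfolding b_def using \<open>F \<noteq> {}\<close> by (subst Min_gr_iff) auto
    then have "0 < e" using D(1) by (simp add: e_def)
    have bound: "\<bar>e * D $ i $ j\<bar> \<le> X $ i $ j" for i j
    proof (cases "(i, j) \<in> F")
      case True
      have "\<bar>D $ i $ j\<bar> \<le> norm (D $ i)" using component_le_norm_cart by blast
      also have "\<dots> \<le> norm D" by (rule Finite_Cartesian_Product.norm_nth_le)
      finally have "e * \<bar>D $ i $ j\<bar> \<le> b"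
        using \<open>0 < b\<close> D(1) by (simp add: e_def field_simps)
      also have "b \<le> X $ i $ j" unfolding b_def using True by (intro Min_le) force+
      finally show ?thesis using \<open>0 < e\<close> by (simp add: abs_mult)
    qed (use D(2) nonneg in auto)
    have "X + t *\<^sub>R D \<in> feasible_P k" if "\<bar>t\<bar> = e" for t
    proof -
      have "\<bar>t * D $ i $ j\<bar> \<le> X $ i $ j" for i j
        using bound[of i j] that \<open>0 < e\<close> by (simp add: abs_mult)
      then have "0 \<le> X $ i $ j + t * D $ i $ j" for i j
        by (smt (verit))
      then show ?thesis
        using X D by (simp add: feasible_P_def sum.distrib flip: sum_distrib_left)
    qed
    from this[of e] this[of "- e"] have
      "X + e *\<^sub>R D \<in> feasible_P k" "X - e *\<^sub>R D \<in> feasible_P k"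
      using \<open>0 < e\<close> by auto
    moreover have "X = midpoint (X + e *\<^sub>R D) (X - e *\<^sub>R D)"
      by (simp add: midpoint_def flip: scaleR_2)
    moreover have "X + e *\<^sub>R D \<noteq> X - e *\<^sub>R D"
    proof
      assume "X + e *\<^sub>R D = X - e *\<^sub>R D"
      then have "e *\<^sub>R D + e *\<^sub>R D = 0" by (simp add: algebra_simps)
      then show False using \<open>0 < e\<close> D(1) by (simp flip: scaleR_2)
    qed
    ultimately show False
      using assms midpoint_in_open_segment unfolding extreme_point_of_def by metis
  qed
  \<comment> \<open>An integral entry is nonnegative and at most its row sum 1.\<close>
  have "?m * X $ i $ j \<in> {0, 1}" for i j
  proof -
    have "?m * X $ i $ j \<in> \<int>" using \<open>F = {}\<close> by (auto simp: F_def)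
    then obtain z where z: "?m * X $ i $ j = of_int z" by (auto elim: Ints_cases)
    have "?m * X $ i $ j \<le> (\<Sum>j\<in>UNIV. ?m * X $ i $ j)"
      by (rule member_le_sum) (use nonneg in auto)
    then have "real_of_int z \<le> 1" using row z by simp
    moreover have "0 \<le> real_of_int z" using nonneg[of i j] m z by (metis less_imp_le mult_nonneg_nonneg)
    ultimately have "z = 0 \<or> z = 1" by auto
    then show ?thesis using z by auto
  qed
  then show ?thesis using row col by (simp add: feasible_Q_def)
qed

section \<open>Geometry of the feasible sets\<close>

lemma convex_feasible_P: "convex (feasible_P k :: (real ^ 'n::finite ^ 'm::finite) set)"
proof (rule convexI)
  fix X Y :: "real ^ 'n ^ 'm" and u v :: real
  assume "X \<in> feasible_P k" "Y \<in> feasible_P k" "0 \<le> u" "0 \<le> v" "u + v = 1"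
  then show "u *\<^sub>R X + v *\<^sub>R Y \<in> feasible_P k"
    by (simp add: feasible_P_def sum.distrib add_divide_distrib[symmetric]
        distrib_right[symmetric] flip: sum_distrib_left)
qed

lemma compact_feasible_P: "compact (feasible_P k :: (real ^ 'n::finite ^ 'm::finite) set)"
proof -
  have "closed (feasible_P k :: (real ^ 'n ^ 'm) set)"
    unfolding feasible_P_def
    by (intro closed_Collect_conj closed_Collect_all closed_Collect_le closed_Collect_eq
        continuous_intros)
  \<comment> \<open>A crude bound: each entry is at most its row sum, and a Euclidean norm is at
    most the sum of the norms of the components, applied to rows and then to the matrix.\<close>
  moreover have "norm X \<le> real CARD('m) * (real CARD('n) * (1 / real CARD('m)))"
    if X: "X \<in> feasible_P k" for X :: "real ^ 'n ^ 'm"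
  proof -
    have entry: "norm (X $ i $ j) \<le> 1 / real CARD('m)" for i j
    proof -
      have "X $ i $ j \<le> (\<Sum>j\<in>UNIV. X $ i $ j)"
        by (rule member_le_sum) (use X in \<open>auto simp: feasible_P_def\<close>)
      then show ?thesis using X by (simp add: feasible_P_def)
    qed
    have "norm (X $ i) \<le> real CARD('n) * (1 / real CARD('m))" for i
      unfolding norm_vec_def[of "X $ i"]
      by (rule order.trans[OF L2_set_le_sum sum_bounded_above]) (use entry in auto)
    then show ?thesis
      unfolding norm_vec_def[of X]
      by (intro order.trans[OF L2_set_le_sum sum_bounded_above]) auto
  qed
  ultimately show ?thesis
    unfolding compact_eq_bounded_closed bounded_iff by blast
qed

lemma feasible_P_nonempty:
  assumes "(\<Sum>j\<in>UNIV. k j) = CARD('m)"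
  shows "(feasible_P k :: (real ^ 'n::finite ^ 'm::finite) set) \<noteq> {}"
proof -
  have "(\<Sum>j\<in>UNIV. real (k j)) = real CARD('m)"
    using assms by (metis of_nat_sum)
  \<comment> \<open>The witness is the product of the two marginals, \<open>1 / m\<close> and
    \<open>k j / m\<close>.\<close>
  then have "(\<chi> i j. real (k j) / (real CARD('m) * real CARD('m))) \<in>
      (feasible_P k :: (real ^ 'n ^ 'm) set)"
    by (simp add: feasible_P_def flip: sum_divide_distrib)
  then show ?thesis by blast
qed

lemma finite_feasible_Q: "finite (feasible_Q k :: (real ^ 'n::finite ^ 'm::finite) set)"
proof (rule finite_subset)
  show "feasible_Q k \<subseteq> range (\<lambda>f. (\<chi> i j. of_bool (f i j)) :: real ^ 'n ^ 'm)"
  proof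
    fix X :: "real ^ 'n ^ 'm"
    assume "X \<in> feasible_Q k"
    then have "X $ i $ j = of_bool (X $ i $ j = 1)" for i j
      by (auto simp: feasible_Q_def dest!: spec[of _ i] spec[of _ j])
    then have *: "X = (\<chi> i j. of_bool (X $ i $ j = 1))"
      by (simp add: vec_eq_iff)
    show "X \<in> range (\<lambda>f. \<chi> i j. of_bool (f i j))"
      by (rule range_eqI) (rule *)
  qed
qed simp

lemma feasible_P_subset_convex_hull:
  "(feasible_P k :: (real ^ 'n::finite ^ 'm::finite) set) \<subseteq>
     convex hull ((*\<^sub>R) (1 / real CARD('m)) ` feasible_Q k)"
proof -
  have "{X. X extreme_point_of feasible_P k} \<subseteq>
      (*\<^sub>R) (1 / real CARD('m)) ` (feasible_Q k :: (real ^ 'n ^ 'm) set)"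
  proof
    fix X :: "real ^ 'n ^ 'm"
    assume "X \<in> {X. X extreme_point_of feasible_P k}"
    then show "X \<in> (*\<^sub>R) (1 / real CARD('m)) ` feasible_Q k"
      by (intro image_eqI[where x = "real CARD('m) *\<^sub>R X"])
        (auto intro: extreme_point_of_feasible_P)
  qed
  then show ?thesis
    using Krein_Milman_Minkowski[OF compact_feasible_P convex_feasible_P] hull_mono by metis
qed

section \<open>Comparison of the two minima\<close>

lemma linear_cost_P: "linear (cost_P C)"
  by (rule linearI)
    (simp_all add: cost_P_def distrib_right sum.distrib sum_distrib_left mult.assoc)

lemma cost_Q_eq_cost_P:
  fixes X :: "real ^ 'n::finite ^ 'm::finite"
  shows "cost_Q C X = cost_P C ((1 / real CARD('m)) *\<^sub>R X)"
  by (simp add: cost_Q_def cost_P_def)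

text \<open>The half-space on which \<open>f\<close> is at least \<open>c\<close> is convex, so it
  contains the hull as soon as it contains \<open>S\<close>.\<close>

lemma linear_ge_on_convex_hull:
  fixes f :: "'a::real_vector \<Rightarrow> real"
  assumes "linear f" "\<And>y. y \<in> S \<Longrightarrow> c \<le> f y" "x \<in> convex hull S"
  shows "c \<le> f x"
proof -
  have "convex hull S \<subseteq> f -` {c..}"
    by (rule hull_minimal) (use assms(1,2) in \<open>auto intro: convex_linear_vimage\<close>)
  then show ?thesis using assms(3) by auto
qed

text \<open>One known minimiser shows that the infimum is attained, which turns optimality of any
  other point into an equation for its cost.\<close>

lemma optimal_on_iff_optimal_value:
  assumes "optimal_on f S x"
  shows "optimal_on f S y \<longleftrightarrow> y \<in> S \<and> f y = optimal_value f S"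
    and "optimal_value f S = f x"
proof -
  show *: "optimal_value f S = f x"
    unfolding optimal_value_def
    by (rule cInf_eq_minimum) (use assms in \<open>auto simp: is_arg_min_linorder\<close>)
  show "optimal_on f S y \<longleftrightarrow> y \<in> S \<and> f y = optimal_value f S"
    unfolding * using assms by (auto simp: is_arg_min_linorder intro: antisym)
qed

theorem proposition1:
  fixes k :: "'n::finite \<Rightarrow> nat"
    and C :: "real ^ 'n ^ 'm::finite"
  assumes "0 < CARD('n)" and "CARD('n) \<le> CARD('m)"
    and "\<And>j. 0 < k j"
    and "(\<Sum>j\<in>UNIV. k j) = CARD('m)"
  shows "(\<exists>X'. optimal_on (cost_P C) (feasible_P k) X') \<and>
         (\<exists>X. optimal_on (cost_Q C) (feasible_Q k) X) \<and>
         optimal_value (cost_P C) (feasible_P k) = optimal_value (cost_Q C) (feasible_Q k) \<and>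
         (\<forall>X\<in>feasible_Q k.
            (1 / real CARD('m)) *\<^sub>R X \<in> feasible_P k \<and>
            (optimal_on (cost_Q C) (feasible_Q k) X \<longleftrightarrow>
             optimal_on (cost_P C) (feasible_P k) ((1 / real CARD('m)) *\<^sub>R X)))"
proof -
  let ?s = "\<lambda>X :: real ^ 'n ^ 'm. (1 / real CARD('m)) *\<^sub>R X"
  \<comment> \<open>No 0-1 matrix is constructed: were there none, the hull that contains the
    nonempty \<open>feasible_P k\<close> would be empty.\<close>
  have "feasible_Q k \<noteq> ({} :: (real ^ 'n ^ 'm) set)"
    using feasible_P_nonempty[OF assms(4)] feasible_P_subset_convex_hull[of k] by force
  then obtain Y where Y: "optimal_on (cost_Q C) (feasible_Q k) Y"
    using ex_is_arg_min_if_finite[OF finite_feasible_Q] by blast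
  then have "Y \<in> feasible_Q k" by (simp add: is_arg_min_def)
  \<comment> \<open>Minimality of \<open>Y\<close> bounds the cost on the scaled 0-1 matrices, and
    linearity extends the bound to their hull.\<close>
  have "cost_P C (?s Y) \<le> cost_P C X" if "X \<in> feasible_P k" for X
  proof (rule linear_ge_on_convex_hull[OF linear_cost_P])
    show "X \<in> convex hull (?s ` feasible_Q k)"
      using that feasible_P_subset_convex_hull by blast
  qed (use Y in \<open>auto simp: is_arg_min_linorder cost_Q_eq_cost_P\<close>)
  then have sY: "optimal_on (cost_P C) (feasible_P k) (?s Y)"
    using \<open>Y \<in> feasible_Q k\<close> scaleR_feasible_Q_in_feasible_P by (auto simp: is_arg_min_linorder)
  have "optimal_value (cost_P C) (feasible_P k) = optimal_value (cost_Q C) (feasible_Q k)"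
    using optimal_on_iff_optimal_value(2)[OF sY] optimal_on_iff_optimal_value(2)[OF Y]
    by (simp add: cost_Q_eq_cost_P)
  then show ?thesis
    using Y sY scaleR_feasible_Q_in_feasible_P
      optimal_on_iff_optimal_value(1)[OF sY] optimal_on_iff_optimal_value(1)[OF Y]
    by (metis cost_Q_eq_cost_P)
qed

end
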